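(* Let $X\in\mathbb{R}^{n\times p}$ and $\beta\in\mathbb{R}^p$ with $\mathrm{patt}(\beta)=M\ne0$, and let $\Lambda\in\mathbb{R}^{p+}$ be fixed. The following statements are equivalent: (i) There exist $\alpha>0$ and $\hat\beta\in S_{X,\alpha\Lambda}(X\beta)$ such that $\mathrm{patt}(\hat\beta)=\mathrm{patt}(\beta)$. (ii) There exists $\alpha_0>0$ such that for all $\alpha\in(0,\alpha_0)$ there exists $\hat\beta\in S_{X,\alpha\Lambda}(X\beta)$ for which $\mathrm{patt}(\hat\beta)=\mathrm{patt}(\beta)$. (iii) $X'(\tilde X_M')^+\tilde\Lambda_M\in\partial J_\Lambda(M)$.
   Context: Notation: $A'$ is the transpose, $A^+$ the Moore-Penrose pseudo-inverse, $\|\cdot\|_\infty$ the maximum absolute entry. $\mathbb{R}^{k+}=\{\kappa\in\mathbb{R}^k:\kappa_1>\dots>\kappa_k>0\}$. SLOPE pattern: for $b\in\mathbb{R}^p$, $\mathrm{patt}(b)_i=\mathrm{sign}(b_i)\,\mathrm{rank}(|b|)_i$, where $k$ is the number of distinct nonzero values in $\{|b_1|,\dots,|b_p|\}$, $\mathrm{rank}(|b|)_i\in\{0,1,\dots,k\}$, $\mathrm{rank}(|b|)_i=0$ if $b_i=0$, $\mathrm{rank}(|b|)_i>0$ if $b_i\ne0$, and $\mathrm{rank}(|b|)_i<\mathrm{rank}(|b|)_j$ if $|b_i|<|b_j|$ (so $\mathrm{rank}(|b|)_i$ is the number of distinct nonzero values of $|b_1|,\dots,|b_p|$ that are $\le|b_i|$).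 For a pattern $M\ne0$ with $k=\|M\|_\infty$, the pattern matrix $U_M\in\mathbb{R}^{p\times k}$ is $(U_M)_{ij}=\mathrm{sign}(M_i)\mathbf 1_{(|M_i|=k+1-j)}$. $|M|_\downarrow$ is the vector of absolute values of the components of $M$ in nonincreasing order. $\tilde X_M=XU_M$ and $\tilde\Lambda_M=(U_{|M|_\downarrow})'\Lambda\in\mathbb{R}^k$. For $\Lambda=(\lambda_1,\dots,\lambda_p)'\in\mathbb{R}^{p+}$: $J_\Lambda(b)=\sum_{i=1}^p\lambda_i|b|_{(i)}$, where $|b|_{(1)}\ge\dots\ge|b|_{(p)}$ are the sorted absolute values of the components of $b$; $\partial J_\Lambda(b)=\{v\in\mathbb{R}^p: J_\Lambda(z)\ge J_\Lambda(b)+v'(z-b)\ \forall z\in\mathbb{R}^p\}$. $S_{X,\alpha\Lambda}(Y)=\arg\min_{b\in\mathbb{R}^p}\{\frac12\|Y-Xb\|_2^2+\alpha J_\Lambda(b)\}$ is the set of SLOPE minimizers with scaled penalty. *)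

theory Defs
  imports Complex_Main "Jordan_Normal_Form.Matrix"
begin

text \<open>
  Vectors and matrices carry their dimensions as values, because the number of columns of a
  pattern matrix depends on the pattern.  Indices start at 0, so the mathematical index \<open>i\<close>
  is \<open>i - 1\<close> here.
\<close>

definition strict_decr_vecs :: "nat \<Rightarrow> real vec set" where
  "strict_decr_vecs k =
     {v \<in> carrier_vec k. (\<forall>i<k. 0 < v $ i) \<and> (\<forall>i j. i < j \<and> j < k \<longrightarrow> v $ j < v $ i)}"

definition max_abs :: "'a::linordered_idom vec \<Rightarrow> 'a" where
  "max_abs v = Max {\<bar>v $ i\<bar> | i. i < dim_vec v}"

definition sorted_abs :: "'a::linordered_idom vec \<Rightarrow> 'a vec" where
  "sorted_abs v = vec_of_list (rev (sort (map abs (list_of_vec v))))"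

definition abs_rank :: "real vec \<Rightarrow> nat \<Rightarrow> nat" where
  "abs_rank b i = card {\<bar>b $ j\<bar> | j. j < dim_vec b \<and> b $ j \<noteq> 0 \<and> \<bar>b $ j\<bar> \<le> \<bar>b $ i\<bar>}"

definition patt :: "real vec \<Rightarrow> int vec" where
  "patt b = vec (dim_vec b)
     (\<lambda>i. (if b $ i > 0 then 1 else if b $ i < 0 then - 1 else 0) * int (abs_rank b i))"

text \<open>With 0-based columns, the condition \<open>\<bar>M\<^sub>i\<bar> = k + 1 - j\<close> becomes \<open>\<bar>M\<^sub>i\<bar> = k - j\<close>.\<close>

definition pattern_matrix :: "int vec \<Rightarrow> real mat" where
  "pattern_matrix M = mat (dim_vec M) (nat (max_abs M))
     (\<lambda>(i, j). real_of_int (sgn (M $ i)) * (if \<bar>M $ i\<bar> = max_abs M - int j then 1 else 0))"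

text \<open>The four Penrose equations determine the pseudo-inverse uniquely.\<close>

definition is_mp_inverse :: "real mat \<Rightarrow> real mat \<Rightarrow> bool" where
  "is_mp_inverse A B \<longleftrightarrow>
     B \<in> carrier_mat (dim_col A) (dim_row A) \<and>
     A * B * A = A \<and> B * A * B = B \<and>
     transpose_mat (A * B) = A * B \<and> transpose_mat (B * A) = B * A"

definition mp_inverse :: "real mat \<Rightarrow> real mat" where
  "mp_inverse A = (THE B. is_mp_inverse A B)"

definition slope_norm :: "real vec \<Rightarrow> real vec \<Rightarrow> real" where
  "slope_norm \<Lambda> b = (\<Sum>i<dim_vec b. \<Lambda> $ i * sorted_abs b $ i)"

definition slope_subdiff :: "real vec \<Rightarrow> real vec \<Rightarrow> real vec set" where
  "slope_subdiff \<Lambda> b = {v \<in> carrier_vec (dim_vec b).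
     \<forall>z \<in> carrier_vec (dim_vec b). slope_norm \<Lambda> z \<ge> slope_norm \<Lambda> b + v \<bullet> (z - b)}"

definition slope_objective :: "real mat \<Rightarrow> real \<Rightarrow> real vec \<Rightarrow> real vec \<Rightarrow> real vec \<Rightarrow> real" where
  "slope_objective X \<alpha> \<Lambda> Y b =
     1 / 2 * ((Y - X *\<^sub>v b) \<bullet> (Y - X *\<^sub>v b)) + \<alpha> * slope_norm \<Lambda> b"

definition slope_minimizers :: "real mat \<Rightarrow> real \<Rightarrow> real vec \<Rightarrow> real vec \<Rightarrow> real vec set" where
  "slope_minimizers X \<alpha> \<Lambda> Y =
     {b. is_arg_min (slope_objective X \<alpha> \<Lambda> Y) (\<lambda>c. c \<in> carrier_vec (dim_col X)) b}"

definition reduced_design :: "real mat \<Rightarrow> int vec \<Rightarrow> real mat" where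
  "reduced_design X M = X * pattern_matrix M"

definition reduced_penalty :: "real vec \<Rightarrow> int vec \<Rightarrow> real vec" where
  "reduced_penalty \<Lambda> M = transpose_mat (pattern_matrix (sorted_abs M)) *\<^sub>v \<Lambda>"

end

theory Submission
  imports Defs "Jordan_Normal_Form.Gauss_Jordan_Elimination"
begin

text \<open>
  Write \<open>U\<close> for the pattern matrix of \<open>M\<close>, \<open>A = X U\<close> for the reduced design and \<open>l\<close> for the reduced
  penalty.  The vectors of pattern \<open>M\<close> are exactly the vectors \<open>U \<kappa>\<close> with \<open>\<kappa>\<close> positive and strictly
  decreasing (lemmas \<open>patt_imp_pattern_matrix_mult\<close> and \<open>patt_pattern_matrix_mult\<close>), and on them the
  SLOPE norm is the linear function \<open>l \<bullet> \<kappa>\<close>.  Since these \<open>\<kappa>\<close> form an open set, a subgradient \<open>v\<close> at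
  \<open>U \<kappa>\<close> must satisfy \<open>U\<^sup>T v = l\<close>; conversely this equation together with \<open>v \<bullet> z \<le> J z\<close> for all \<open>z\<close>
  makes \<open>v\<close> a subgradient (\<open>slope_subdiff_pattern_iff\<close>).  Neither condition mentions \<open>\<kappa>\<close>, so the
  subdifferential is the same set at all vectors of pattern \<open>M\<close>, and in particular at \<open>M\<close> itself.

  Let \<open>\<beta> = U s\<close>.  By convexity of the norm, \<open>U \<kappa>\<close> is a minimizer exactly when
  \<open>X\<^sup>T (X \<beta> - X U \<kappa>) / \<alpha>\<close> is a subgradient there (\<open>slope_minimizers_iff_subdiff\<close>).  With
  \<open>c = (s - \<kappa>) / \<alpha>\<close> this vector is \<open>X\<^sup>T (A c)\<close>.  If it is a subgradient, then \<open>A\<^sup>T (A c) = l\<close>; as \<open>A c\<close>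
  lies in the range of \<open>A\<close>, it is the pseudo-inverse of \<open>A\<^sup>T\<close> applied to \<open>l\<close>, which yields the
  subdifferential condition.  Conversely, the pseudo-inverse of \<open>A\<^sup>T\<close> maps \<open>l\<close> to some \<open>A c\<close>.  If
  \<open>X\<^sup>T (A c)\<close> is a subgradient at \<open>M\<close>, then \<open>U (s - \<alpha> c)\<close> is a minimizer for every \<open>\<alpha> > 0\<close> for which
  \<open>s - \<alpha> c\<close> is still positive and strictly decreasing, that is, for every sufficiently small \<open>\<alpha>\<close>.
\<close>


section \<open>Existence and uniqueness of the Moore-Penrose inverse\<close>

text \<open>
  Associativity and transposition with side conditions on dimensions instead of carriers, which lets
  the simplifier regroup long products of rectangular matrices.
\<close>

lemma mult_mat_assoc_dims:
  fixes A B C :: "'a::semiring_0 mat"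
  assumes "dim_col A = dim_row B" and "dim_col B = dim_row C"
  shows "A * B * C = A * (B * C)"
  by (rule assoc_mult_mat[of A "dim_row A" "dim_row B" B "dim_row C" C "dim_col C"])
    (auto intro!: carrier_matI simp: assms)

lemma transpose_mult_dims:
  fixes A B :: "'a::comm_semiring_0 mat"
  assumes "dim_col A = dim_row B"
  shows "transpose_mat (A * B) = transpose_mat B * transpose_mat A"
  by (rule transpose_mult[of A "dim_row A" "dim_row B" B "dim_col B"])
    (auto intro!: carrier_matI simp: assms)

text \<open>
  The transposed position matrix of the pivots is a generalized inverse: the pivot columns of \<open>R\<close> are
  unit vectors, so \<open>R Q\<close> is the diagonal projection onto the rows that have a pivot, and the remaining
  rows of \<open>R\<close> vanish.
\<close>

lemma generalized_inverse_row_echelon: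
  fixes R :: "'a::field mat"
  assumes R: "R \<in> carrier_mat n m" and ech: "row_echelon_form R"
  shows "\<exists>Q \<in> carrier_mat m n. R * Q * R = R"
proof -
  obtain f where "pivot_fun R f m"
    using ech R unfolding row_echelon_form_def by auto
  note f = pivot_funD[OF carrier_matD(1)[OF R] this]
  define Q where "Q = mat m n (\<lambda>(j, i). if f i = j then 1 else (0::'a))"
  have Q: "Q \<in> carrier_mat m n" by (simp add: Q_def)
  have RQ: "(R * Q) $$ (i, j) = (if i = j \<and> f i < m then 1 else 0)"
    if "i < n" "j < n" for i j
  proof -
    have "(R * Q) $$ (i, j) = (\<Sum>k<m. R $$ (i, k) * Q $$ (k, j))"
      using that R Q by (simp add: scalar_prod_def atLeast0LessThan)
    also have "\<dots> = (\<Sum>k<m. if k = f j then R $$ (i, f j) else 0)"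
      using that by (intro sum.cong) (auto simp: Q_def)
    also have "\<dots> = (if f j < m then R $$ (i, f j) else 0)"
      by simp
    finally show ?thesis using f(4)[of j] f(5)[of j i] that by auto
  qed
  have "R * Q * R = R"
  proof (rule eq_matI)
    fix i j assume "i < dim_row R" "j < dim_col R"
    then have ij: "i < n" "j < m" using R by auto
    have "(R * Q * R) $$ (i, j) = (\<Sum>k<n. (R * Q) $$ (i, k) * R $$ (k, j))"
      using ij R Q by (simp add: scalar_prod_def atLeast0LessThan del: assoc_mult_mat)
    also have "\<dots> = (\<Sum>k<n. if k = i then (if f i < m then R $$ (i, j) else 0) else 0)"
      by (rule sum.cong) (simp_all add: RQ[OF ij(1)] del: index_mult_mat)
    also have "\<dots> = R $$ (i, j)"
      using f(1)[OF ij(1)] f(2)[OF ij(1), of j] ij by (simp add: not_less)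
    finally show "(R * Q * R) $$ (i, j) = R $$ (i, j)" .
  qed (use R Q in auto)
  with Q show ?thesis by blast
qed

text \<open>
  Gauss-Jordan elimination writes \<open>R = P A\<close> with \<open>P\<close> invertible, and \<open>Q P\<close> is a generalized inverse of
  \<open>A\<close> whenever \<open>Q\<close> is one of \<open>R\<close>.
\<close>

lemma generalized_inverse_exists:
  fixes A :: "'a::field mat"
  assumes A: "A \<in> carrier_mat n m"
  shows "\<exists>K \<in> carrier_mat m n. A * K * A = A"
proof -
  obtain R where R_def: "gauss_jordan_single A = R" by blast
  note gj = gauss_jordan_single[OF A R_def]
  obtain P P' where P: "R = P * A" "P \<in> carrier_mat n n" "P' \<in> carrier_mat n n" "P' * P = 1\<^sub>m n"
    using gj(4) by blast
  obtain Q where Q: "Q \<in> carrier_mat m n" "R * Q * R = R"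
    using generalized_inverse_row_echelon[OF gj(2,3)] by blast
  have A_eq: "A = P' * R"
    using P A by (simp add: assoc_mult_mat[symmetric, of _ n n _ n _ m])
  note dims = carrier_matD[OF A] carrier_matD[OF P(2)] carrier_matD[OF P(3)]
    carrier_matD[OF Q(1)] carrier_matD[OF gj(2)]
  have "A * (Q * P) * A = A * (Q * (P * A))"
    by (simp add: dims mult_mat_assoc_dims)
  also have "\<dots> = P' * (R * Q * R)"
    by (simp add: P(1)[symmetric]) (simp add: A_eq dims mult_mat_assoc_dims)
  finally have "A * (Q * P) * A = A" using Q(2) A_eq by simp
  then show ?thesis using P Q by (intro bexI[of _ "Q * P"]) auto
qed

text \<open>
  A column \<open>y\<close> of \<open>Y\<close> satisfies \<open>(A y) \<bullet> (A y) = y \<bullet> (A\<^sup>T A y) = 0\<close>; the squared column norms appear on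
  the diagonal of \<open>(A Y)\<^sup>T (A Y)\<close>.
\<close>

lemma gram_mult_eq_0_imp:
  fixes A :: "real mat"
  assumes A: "A \<in> carrier_mat n m" and Y: "Y \<in> carrier_mat m l"
    and eq0: "transpose_mat A * A * Y = 0\<^sub>m m l"
  shows "A * Y = 0\<^sub>m n l"
proof -
  have AY: "A * Y \<in> carrier_mat n l" using A Y by simp
  have "transpose_mat (A * Y) * (A * Y) = transpose_mat Y * (transpose_mat A * A * Y)"
    using A Y by (simp add: transpose_mult[OF A Y] assoc_mult_mat[of _ l m _ n _ l]
        assoc_mult_mat[of _ m n _ m _ l])
  also have "\<dots> = 0\<^sub>m l l"
    using Y by (simp add: eq0)
  finally have *: "transpose_mat (A * Y) * (A * Y) = 0\<^sub>m l l" .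
  show ?thesis
  proof (rule eq_matI)
    fix i j assume "i < dim_row (0\<^sub>m n l :: real mat)" "j < dim_col (0\<^sub>m n l :: real mat)"
    then have ij: "i < n" "j < l" by auto
    have "(\<Sum>k<n. ((A * Y) $$ (k, j))\<^sup>2) = (transpose_mat (A * Y) * (A * Y)) $$ (j, j)"
      using ij carrier_matD[OF AY]
      by (simp add: scalar_prod_def atLeast0LessThan power2_eq_square del: index_mult_mat assoc_mult_mat
          add: index_mult_mat(1)[of j "transpose_mat (A * Y)" j "A * Y"] index_mult_mat(2,3))
    also have "\<dots> = 0" using ij by (simp add: *)
    finally have "\<forall>k<n. ((A * Y) $$ (k, j))\<^sup>2 = 0"
      by (subst (asm) sum_nonneg_eq_0_iff) auto
    then show "(A * Y) $$ (i, j) = (0\<^sub>m n l :: real mat) $$ (i, j)" using ij by simp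
  qed (use AY in auto)
qed

lemma gram_mult_cancel:
  fixes A :: "real mat"
  assumes A: "A \<in> carrier_mat n m" and Y: "Y \<in> carrier_mat m l" and Z: "Z \<in> carrier_mat m l"
    and eq: "transpose_mat A * A * Y = transpose_mat A * A * Z"
  shows "A * Y = A * Z"
proof -
  have "transpose_mat A * A * (Y - Z) = 0\<^sub>m m l"
    using A Y Z eq by (simp add: mult_minus_distrib_mat[of _ m m])
  then have "A * (Y - Z) = 0\<^sub>m n l"
    using minus_carrier_mat[OF Z] by (intro gram_mult_eq_0_imp[OF A]) simp_all
  then have "A * Y - A * Z = 0\<^sub>m n l"
    using A Y Z by (simp add: mult_minus_distrib_mat[of _ n m])
  moreover have "A * Y = (A * Y - A * Z) + A * Z"
    by (rule eq_matI) (use A Y Z in \<open>simp_all del: index_mult_mat(1)\<close>)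
  ultimately show ?thesis
    using A Z by simp
qed

text \<open>
  From \<open>E\<^sup>T = A F\<^sup>T\<close> and \<open>E A = A\<close> one gets \<open>E E\<^sup>T = E\<^sup>T\<close>, and the left-hand side is symmetric.  This
  delivers the two symmetry conditions of Penrose.
\<close>

lemma projector_onto_range_symmetric:
  fixes A :: "real mat"
  assumes A: "A \<in> carrier_mat n m" and F: "F \<in> carrier_mat n m"
    and E: "E = F * transpose_mat A" and EA: "E * A = A"
  shows "transpose_mat E = E"
proof -
  have tE: "transpose_mat E = A * transpose_mat F"
    using A F by (simp add: E transpose_mult[of _ n m _ n])
  have "E * transpose_mat E = (E * A) * transpose_mat F"
    unfolding tE using A F by (subst assoc_mult_mat[of _ n n _ m _ n]) (auto simp: E)
  then have *: "E * transpose_mat E = transpose_mat E"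
    by (simp add: EA tE)
  have "E \<in> carrier_mat n n" using A F by (simp add: E)
  then show ?thesis
    by (metis * transpose_carrier_mat transpose_mult transpose_transpose)
qed

text \<open>
  Zlobec's formula: \<open>A\<^sup>T K A\<^sup>T\<close> is the pseudo-inverse for any generalized inverse \<open>K\<close> of \<open>A\<^sup>T A A\<^sup>T\<close>.
  In \<open>A\<^sup>T A A\<^sup>T K A\<^sup>T A A\<^sup>T = A\<^sup>T A A\<^sup>T\<close> one may cancel the leading \<open>A\<^sup>T\<close> and, after transposing, the trailing
  one, which leaves \<open>A B A = A\<close>.  The other three equations follow because \<open>B\<close> begins and ends with
  \<open>A\<^sup>T\<close>.
\<close>

lemma mp_inverse_exists: "\<exists>B. is_mp_inverse A B"
proof -
  define n m where "n = dim_row A" and "m = dim_col A"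
  have A: "A \<in> carrier_mat n m" by (simp add: n_def m_def)
  define T where "T = transpose_mat A"
  have T: "T \<in> carrier_mat m n" and TT: "transpose_mat T = A" using A by (auto simp: T_def)
  obtain K where K: "K \<in> carrier_mat n m" and "T * A * T * K * (T * A * T) = T * A * T"
    using generalized_inverse_exists[of "T * A * T" m n] A T by auto
  define B where "B = T * K * T"
  have B: "B \<in> carrier_mat m n" using T K by (simp add: B_def)
  note dims = carrier_matD[OF A] carrier_matD[OF T] carrier_matD[OF K] carrier_matD[OF B]
  note assoc = dims mult_mat_assoc_dims transpose_mult_dims
  have "T * A * (B * A * T) = T * A * T"
    using \<open>T * A * T * K * (T * A * T) = T * A * T\<close> by (simp add: B_def assoc)
  then have "A * (B * A * T) = A * T"
    unfolding T_def by (intro gram_mult_cancel[OF A]) (use A B T in \<open>auto simp: T_def[symmetric]\<close>)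
  then have "transpose_mat (A * (B * A * T)) = transpose_mat (A * T)" by simp
  then have "transpose_mat T * T * transpose_mat (A * B) = transpose_mat T * T * 1\<^sub>m n"
    using A B T by (simp add: TT T_def[symmetric] assoc)
  then have "T * transpose_mat (A * B) = T * 1\<^sub>m n"
    by (intro gram_mult_cancel[OF T]) (use A B T in auto)
  then have "transpose_mat (T * transpose_mat (A * B)) = transpose_mat T"
    using T by simp
  then have ABA: "A * B * A = A"
    using T by (simp add: assoc TT T_def[symmetric])
  then have ABA': "A * (B * A) = A" by (simp add: assoc)
  have sym1: "transpose_mat (A * B) = A * B"
    by (rule projector_onto_range_symmetric[OF A, of "A * T * K"])
      (use A T K B ABA in \<open>simp_all add: B_def assoc T_def[symmetric]\<close>)
  have "transpose_mat (transpose_mat (B * A)) = transpose_mat (B * A)"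
  proof (rule projector_onto_range_symmetric[OF T, of "transpose_mat (K * T * A)"])
    show "transpose_mat (B * A) = transpose_mat (K * T * A) * transpose_mat T"
      using A T K by (simp add: B_def assoc T_def)
    have "transpose_mat (B * A) * T = transpose_mat (A * (B * A))"
      using A B by (simp add: T_def assoc)
    then show "transpose_mat (B * A) * T = T"
      by (simp only: ABA' T_def)
  qed (use A T K in simp_all)
  then have sym2: "transpose_mat (B * A) = B * A" by simp
  have "B * A * T = transpose_mat (A * (B * A))"
    using A B by (simp add: sym2 T_def transpose_mult[of _ n m _ m])
  then have "B * A * T = T"
    by (simp only: ABA' T_def)
  then have "B * A * T * (K * T) = T * (K * T)" by simp
  then have "B * A * B = B"
    using A B T K by (simp add: B_def assoc)
  then show "\<exists>B. is_mp_inverse A B"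
    using A B ABA sym1 sym2 unfolding is_mp_inverse_def by auto
qed

text \<open>
  \<open>A B\<close> and \<open>A C\<close> are symmetric and each is a left identity on the range of \<open>A\<close>, so
  \<open>A B = (A C) (A B) = ((A B) (A C))\<^sup>T = A C\<close>, and likewise \<open>B A = C A\<close>.  Hence
  \<open>B = B A B = C A C = C\<close>.
\<close>

lemma mp_inverse_unique:
  assumes "is_mp_inverse A B" and "is_mp_inverse A C"
  shows "B = C"
proof -
  define n m where "n = dim_row A" and "m = dim_col A"
  have A: "A \<in> carrier_mat n m" by (simp add: n_def m_def)
  have B: "B \<in> carrier_mat m n" "A * B * A = A" "B * A * B = B"
      "transpose_mat (A * B) = A * B" "transpose_mat (B * A) = B * A"
    and C: "C \<in> carrier_mat m n" "A * C * A = A" "C * A * C = C"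
      "transpose_mat (A * C) = A * C" "transpose_mat (C * A) = C * A"
    using assms by (auto simp: is_mp_inverse_def n_def m_def)
  note dims = carrier_matD[OF A] carrier_matD[OF B(1)] carrier_matD[OF C(1)]
  note assoc = dims mult_mat_assoc_dims
  have "A * B = (A * C) * (A * B)"
    using A B(1) C(1,2) by (simp add: assoc_mult_mat[symmetric, of "A * C" n n A m B n])
  also have "\<dots> = transpose_mat ((A * B) * (A * C))"
    using A B(1) C(1) by (simp add: transpose_mult[of "A * B" n n _ n] B(4) C(4))
  also have "(A * B) * (A * C) = A * C"
    using A B(1,2) C(1) by (simp add: assoc_mult_mat[symmetric, of "A * B" n n A m C n])
  finally have AB: "A * B = A * C" by (simp add: C(4))
  have "B * A = (B * A) * (C * A)"
    using A B(1) C(1,2) by (simp add: assoc)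
  also have "\<dots> = transpose_mat ((C * A) * (B * A))"
    using A B(1) C(1) by (simp add: transpose_mult[of "C * A" m m _ m] B(5) C(5))
  also have "(C * A) * (B * A) = C * A"
    using A B(1,2) C(1) by (simp add: assoc)
  finally have BA: "B * A = C * A" by (simp add: C(5))
  have "B = B * (A * C)"
    using A B(1,3) by (simp add: AB[symmetric] assoc)
  also have "\<dots> = C * A * C"
    using A B(1) C(1) by (simp add: BA[symmetric] assoc)
  finally show ?thesis by (simp add: C(3))
qed

lemma is_mp_inverse_mp_inverse: "is_mp_inverse A (mp_inverse A)"
  unfolding mp_inverse_def using mp_inverse_exists mp_inverse_unique by (metis theI)

text \<open>
  The pseudo-inverse \<open>B\<close> of \<open>T = A\<^sup>T\<close> inverts \<open>T\<close> on the range of \<open>A\<close>: transposing \<open>T B T = T\<close> and using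
  the symmetry of \<open>B T\<close> gives \<open>B T A = A\<close>.
\<close>

lemma mp_inverse_transpose_left_inverse:
  fixes A :: "real mat"
  assumes A: "A \<in> carrier_mat n k" and c: "c \<in> carrier_vec k"
  shows "mp_inverse (transpose_mat A) *\<^sub>v (transpose_mat A *\<^sub>v (A *\<^sub>v c)) = A *\<^sub>v c"
proof -
  define T B where "T = transpose_mat A" and "B = mp_inverse T"
  have T: "T \<in> carrier_mat k n" using A by (simp add: T_def)
  have B: "B \<in> carrier_mat n k" and TBT: "T * B * T = T" and sym: "transpose_mat (B * T) = B * T"
    using is_mp_inverse_mp_inverse[of T] T by (auto simp: is_mp_inverse_def B_def)
  have "B * T * A = transpose_mat (T * (B * T))"
    using A B T by (subst sym[symmetric]) (simp add: transpose_mult_dims T_def mult_mat_assoc_dims)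
  also have "\<dots> = transpose_mat T"
    using TBT T B by (simp add: mult_mat_assoc_dims)
  finally have "B * T * A = A" by (simp add: T_def)
  then have "(B * T * A) *\<^sub>v c = A *\<^sub>v c" by simp
  then have "B *\<^sub>v (T *\<^sub>v (A *\<^sub>v c)) = A *\<^sub>v c"
    using A B T c by (simp add: assoc_mult_mat_vec[of _ n n _ k] assoc_mult_mat_vec[of _ n k _ n]
       assoc_mult_mat_vec[of _ n k _ k] assoc_mult_mat_vec[of _ k n _ k])
  then show ?thesis by (simp add: T_def B_def)
qed

text \<open>
  With \<open>B\<close> the pseudo-inverse of \<open>T = A\<^sup>T\<close>, symmetry of \<open>B T\<close> gives \<open>B = (B T)\<^sup>T B = A (B\<^sup>T B)\<close>, so the
  range of \<open>B\<close> is contained in that of \<open>A\<close>.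
\<close>

lemma mp_inverse_transpose_in_range:
  fixes A :: "real mat"
  assumes A: "A \<in> carrier_mat n k" and y: "y \<in> carrier_vec k"
  obtains c where "c \<in> carrier_vec k" and "mp_inverse (transpose_mat A) *\<^sub>v y = A *\<^sub>v c"
proof
  define T B where "T = transpose_mat A" and "B = mp_inverse T"
  have T: "T \<in> carrier_mat k n" using A by (simp add: T_def)
  have B: "B \<in> carrier_mat n k" and BTB: "B * T * B = B" and sym: "transpose_mat (B * T) = B * T"
    using is_mp_inverse_mp_inverse[of T] T by (auto simp: is_mp_inverse_def B_def)
  have "B = transpose_mat (B * T) * B" by (simp add: BTB sym)
  then have eq: "B = A * (transpose_mat B * B)"
    using A B T by (simp add: transpose_mult_dims T_def mult_mat_assoc_dims)
  show "(transpose_mat B * B) *\<^sub>v y \<in> carrier_vec k" using B y by simp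
  have "A *\<^sub>v ((transpose_mat B * B) *\<^sub>v y) = (A * (transpose_mat B * B)) *\<^sub>v y"
    using assoc_mult_mat_vec[of A n k "transpose_mat B * B" k y] A B y by simp
  then show "mp_inverse (transpose_mat A) *\<^sub>v y = A *\<^sub>v ((transpose_mat B * B) *\<^sub>v y)"
    by (simp flip: eq T_def B_def)
qed

section \<open>Convexity of the sorted weighted norm\<close>

text \<open>
  Sorting in decreasing order is sorting by the key \<open>- f x\<close>; this form exposes the insertion step
  for induction and records the underlying rearrangement of the indices.
\<close>

lemma rev_sort_map:
  fixes f :: "'b \<Rightarrow> 'a::linordered_idom"
  shows "rev (sort (map f xs)) = map f (sort_key (\<lambda>x. - f x) xs)"
proof -
  have "sorted (rev (map f (sort_key (\<lambda>x. - f x) xs)))"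
    using sorted_sort_key[of "\<lambda>x. - f x" xs]
    by (simp add: sorted_wrt_rev sorted_wrt_map)
  then have "sort (map f xs) = rev (map f (sort_key (\<lambda>x. - f x) xs))"
    by (intro properties_for_sort) simp_all
  then show ?thesis by simp
qed

text \<open>
  The rearrangement inequality is proved along insertion sort: each time the new entry \<open>x\<close> passes a
  larger entry \<open>y\<close>, the weighted sum grows by \<open>(l 0 - l 1) * (y - x) \<ge> 0\<close>.
\<close>

lemma weighted_sum_le_insort:
  fixes l :: "nat \<Rightarrow> 'a::linordered_idom"
  assumes "\<And>i. i < length ys \<Longrightarrow> l (Suc i) \<le> l i"
  shows "(\<Sum>i<Suc (length ys). l i * (x # ys) ! i)
       \<le> (\<Sum>i<Suc (length ys). l i * insort_key uminus x ys ! i)"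
  using assms
proof (induction ys arbitrary: l)
  case (Cons y ys)
  show ?case
  proof (cases "y \<le> x")
    case False
    have "(l 0 - l 1) * (y - x) \<ge> 0"
      using Cons.prems[of 0] False by (intro mult_nonneg_nonneg) auto
    then have swap: "l 0 * x + l 1 * y \<le> l 0 * y + l 1 * x"
      by (simp add: algebra_simps)
    have "(\<Sum>i<Suc (length ys). l (Suc i) * (x # ys) ! i)
        \<le> (\<Sum>i<Suc (length ys). l (Suc i) * insort_key uminus x ys ! i)"
      using Cons.prems by (intro Cons.IH) auto
    with swap False show ?thesis
      by (simp add: sum.lessThan_Suc_shift del: sum.lessThan_Suc)
  qed simp
qed simp

lemma weighted_sum_le_sorted:
  fixes l :: "nat \<Rightarrow> 'a::linordered_idom"
  assumes "\<And>i. Suc i < length xs \<Longrightarrow> l (Suc i) \<le> l i"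
  shows "(\<Sum>i<length xs. l i * xs ! i) \<le> (\<Sum>i<length xs. l i * rev (sort xs) ! i)"
proof -
  have "(\<Sum>i<length xs. l i * xs ! i) \<le> (\<Sum>i<length xs. l i * sort_key uminus xs ! i)"
    using assms
  proof (induction xs arbitrary: l)
    case (Cons x xs)
    have "(\<Sum>i<length xs. l (Suc i) * xs ! i) \<le> (\<Sum>i<length xs. l (Suc i) * sort_key uminus xs ! i)"
      using Cons.prems by (intro Cons.IH) simp
    then have "(\<Sum>i<Suc (length xs). l i * (x # xs) ! i)
        \<le> (\<Sum>i<Suc (length xs). l i * (x # sort_key uminus xs) ! i)"
      by (simp add: sum.lessThan_Suc_shift del: sum.lessThan_Suc)
    also have "\<dots> \<le> (\<Sum>i<Suc (length xs). l i * insort_key uminus x (sort_key uminus xs) ! i)"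
      using weighted_sum_le_insort[of "sort_key uminus xs" l x] Cons.prems by simp
    finally show ?case by simp
  qed simp
  then show ?thesis
    using rev_sort_map[of "\<lambda>x. x" xs] by simp
qed

text \<open>
  Together with \<open>slope_norm_attained\<close> this exhibits the norm as a maximum, over all permutations of the
  indices, of weighted sums of absolute values, which are convex.  A permutation is encoded as a list
  of indices.
\<close>

lemma weighted_sum_le_slope_norm:
  assumes "\<Lambda> \<in> strict_decr_vecs p" and "z \<in> carrier_vec p" and "mset is = mset [0..<p]"
  shows "(\<Sum>i<p. \<Lambda> $ i * \<bar>z $ (is ! i)\<bar>) \<le> slope_norm \<Lambda> z"
proof -
  let ?xs = "map (\<lambda>j. \<bar>z $ j\<bar>) is"
  have len: "length is = p" using mset_eq_length[OF assms(3)] by simp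
  have "mset ?xs = mset (map abs (list_of_vec z))"
    using assms(2,3) by (simp add: list_of_vec_map multiset.map_comp comp_def)
  then have "sort ?xs = sort (map abs (list_of_vec z))"
    by (metis properties_for_sort mset_sort sorted_sort)
  moreover have "(\<Sum>i<length ?xs. \<Lambda> $ i * ?xs ! i) \<le> (\<Sum>i<length ?xs. \<Lambda> $ i * rev (sort ?xs) ! i)"
    using assms(1) by (intro weighted_sum_le_sorted) (auto simp: strict_decr_vecs_def len less_imp_le)
  ultimately show ?thesis
    using assms(2) by (simp add: slope_norm_def sorted_abs_def len vec_of_list_index)
qed

lemma slope_norm_attained:
  assumes "z \<in> carrier_vec p"
  obtains "is" where "mset is = mset [0..<p]"
    and "slope_norm \<Lambda> z = (\<Sum>i<p. \<Lambda> $ i * \<bar>z $ (is ! i)\<bar>)"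
proof
  define is' where "is' = sort_key (\<lambda>i. - \<bar>z $ i\<bar>) [0..<p]"
  show mset: "mset is' = mset [0..<p]" by (simp add: is'_def)
  have len: "length is' = p" by (simp add: is'_def)
  have "rev (sort (map abs (list_of_vec z))) = map (\<lambda>i. \<bar>z $ i\<bar>) is'"
    using assms rev_sort_map[of "\<lambda>i. \<bar>z $ i\<bar>" "[0..<p]"] by (simp add: list_of_vec_map comp_def is'_def)
  then show "slope_norm \<Lambda> z = (\<Sum>i<p. \<Lambda> $ i * \<bar>z $ (is' ! i)\<bar>)"
    using assms by (simp add: slope_norm_def sorted_abs_def vec_of_list_index len)
qed

text \<open>
  The permutation that attains the norm at the intermediate point gives a convex function, which is
  at most the norm at both end points.
\<close>

lemma slope_norm_convex:
  assumes L: "\<Lambda> \<in> strict_decr_vecs p" and a: "a \<in> carrier_vec p" and b: "b \<in> carrier_vec p"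
    and t: "0 \<le> t" "t \<le> 1"
  shows "slope_norm \<Lambda> (a + t \<cdot>\<^sub>v (b - a)) \<le> (1 - t) * slope_norm \<Lambda> a + t * slope_norm \<Lambda> b"
proof -
  let ?z = "a + t \<cdot>\<^sub>v (b - a)"
  have "?z \<in> carrier_vec p" using a b by auto
  then obtain "is" where "is": "mset is = mset [0..<p]"
    and eq: "slope_norm \<Lambda> ?z = (\<Sum>i<p. \<Lambda> $ i * \<bar>?z $ (is ! i)\<bar>)"
    by (rule slope_norm_attained)
  have lt: "is ! i < p" if "i < p" for i
    using mset_eq_length[OF "is"] mset_eq_setD[OF "is"] that nth_mem[of i "is"] by auto
  have "\<Lambda> $ i * \<bar>?z $ (is ! i)\<bar>
      \<le> (1 - t) * (\<Lambda> $ i * \<bar>a $ (is ! i)\<bar>) + t * (\<Lambda> $ i * \<bar>b $ (is ! i)\<bar>)" if i: "i < p" for i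
  proof -
    have "?z $ (is ! i) = (1 - t) * a $ (is ! i) + t * b $ (is ! i)"
      using lt[OF i] a b by (simp add: algebra_simps)
    then have "\<bar>?z $ (is ! i)\<bar> \<le> (1 - t) * \<bar>a $ (is ! i)\<bar> + t * \<bar>b $ (is ! i)\<bar>"
      using t abs_triangle_ineq[of "(1 - t) * a $ (is ! i)" "t * b $ (is ! i)"] by (simp add: abs_mult)
    then have "\<Lambda> $ i * \<bar>?z $ (is ! i)\<bar> \<le> \<Lambda> $ i * ((1 - t) * \<bar>a $ (is ! i)\<bar> + t * \<bar>b $ (is ! i)\<bar>)"
      using L i by (intro mult_left_mono) (auto simp: strict_decr_vecs_def less_imp_le)
    then show ?thesis by (simp add: algebra_simps)
  qed
  then have "slope_norm \<Lambda> ?z \<le> (1 - t) * (\<Sum>i<p. \<Lambda> $ i * \<bar>a $ (is ! i)\<bar>)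
      + t * (\<Sum>i<p. \<Lambda> $ i * \<bar>b $ (is ! i)\<bar>)"
    unfolding eq sum_distrib_left sum.distrib[symmetric] by (intro sum_mono) simp
  also have "\<dots> \<le> (1 - t) * slope_norm \<Lambda> a + t * slope_norm \<Lambda> b"
    using t weighted_sum_le_slope_norm[OF L a "is"] weighted_sum_le_slope_norm[OF L b "is"]
    by (intro add_mono mult_left_mono) auto
  finally show ?thesis .
qed

section \<open>First-order optimality\<close>

lemma eventually_positive_shift:
  fixes a d :: real
  assumes "0 < a"
  shows "\<forall>\<^sub>F t in at_right 0. 0 < a + t * d"
proof -
  have "((\<lambda>t. a + t * d) \<longlongrightarrow> a + 0 * d) (at_right 0)"
    by (intro tendsto_intros)
  then show ?thesis using assms by (simp add: order_tendstoD(1))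
qed

lemma slope_objective_expansion:
  assumes X: "X \<in> carrier_mat n p" and Y: "Y \<in> carrier_vec n"
    and b: "b \<in> carrier_vec p" and z: "z \<in> carrier_vec p"
  shows "slope_objective X \<alpha> \<Lambda> Y z = slope_objective X \<alpha> \<Lambda> Y b
      - (transpose_mat X *\<^sub>v (Y - X *\<^sub>v b)) \<bullet> (z - b)
      + 1 / 2 * ((X *\<^sub>v (z - b)) \<bullet> (X *\<^sub>v (z - b)))
      + \<alpha> * (slope_norm \<Lambda> z - slope_norm \<Lambda> b)"
proof -
  define r u where "r = Y - X *\<^sub>v b" and "u = X *\<^sub>v (z - b)"
  have r: "r \<in> carrier_vec n" and u: "u \<in> carrier_vec n"
    using X Y b z by (auto simp: r_def u_def)
  have "Y - X *\<^sub>v z = r - u"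
    using X Y b z by (auto simp: r_def u_def mult_minus_distrib_mat_vec)
  moreover have "(r - u) \<bullet> (r - u) = r \<bullet> r - 2 * (r \<bullet> u) + u \<bullet> u"
    using r u comm_scalar_prod[OF r u]
    by (simp add: minus_scalar_prod_distrib[of _ n] scalar_prod_minus_distrib[of _ n])
  moreover have "(transpose_mat X *\<^sub>v r) \<bullet> (z - b) = r \<bullet> u"
    using transpose_vec_mult_scalar[OF X _ r, of "z - b"] b z by (simp add: u_def)
  ultimately show ?thesis
    unfolding slope_objective_def r_def[symmetric] u_def[symmetric] by (simp add: algebra_simps)
qed

text \<open>
  Fermat's rule.  By the expansion around \<open>b\<close>, the objective at \<open>z\<close> exceeds its value at \<open>b\<close> by
  \<open>\<alpha> D z + Q z / 2\<close>, where \<open>D z\<close> is the slack of the subgradient inequality and \<open>Q z\<close> is quadratic and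
  nonnegative in \<open>z - b\<close>.  So \<open>D \<ge> 0\<close> suffices.  It is necessary because, at distance \<open>t\<close> from \<open>b\<close> on
  the segment towards \<open>z\<close>, the slack is at most \<open>t D z\<close> by convexity while the quadratic term is
  \<open>t\<^sup>2 Q z\<close>.
\<close>

lemma slope_minimizers_iff_subdiff:
  assumes X: "X \<in> carrier_mat n p" and Y: "Y \<in> carrier_vec n" and b: "b \<in> carrier_vec p"
    and L: "\<Lambda> \<in> strict_decr_vecs p" and \<alpha>: "0 < \<alpha>" and v: "v \<in> carrier_vec p"
    and grad: "transpose_mat X *\<^sub>v (Y - X *\<^sub>v b) = \<alpha> \<cdot>\<^sub>v v"
  shows "b \<in> slope_minimizers X \<alpha> \<Lambda> Y \<longleftrightarrow> v \<in> slope_subdiff \<Lambda> b"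
proof -
  let ?Q = "\<lambda>z. (X *\<^sub>v (z - b)) \<bullet> (X *\<^sub>v (z - b))"
  let ?D = "\<lambda>z. slope_norm \<Lambda> z - slope_norm \<Lambda> b - v \<bullet> (z - b)"
  have expand: "slope_objective X \<alpha> \<Lambda> Y z - slope_objective X \<alpha> \<Lambda> Y b = \<alpha> * ?D z + 1 / 2 * ?Q z"
    if "z \<in> carrier_vec p" for z
    using slope_objective_expansion[OF X Y b that, of \<alpha> \<Lambda>] that v b
    by (simp add: grad algebra_simps)
  have "b \<in> slope_minimizers X \<alpha> \<Lambda> Y \<longleftrightarrow>
      (\<forall>z\<in>carrier_vec p. 0 \<le> slope_objective X \<alpha> \<Lambda> Y z - slope_objective X \<alpha> \<Lambda> Y b)"
    using X b by (auto simp: slope_minimizers_def is_arg_min_def not_less)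
  also have "\<dots> \<longleftrightarrow> (\<forall>z\<in>carrier_vec p. 0 \<le> \<alpha> * ?D z + 1 / 2 * ?Q z)"
    by (rule ball_cong[OF refl]) (simp only: expand)
  also have "\<dots> \<longleftrightarrow> (\<forall>z\<in>carrier_vec p. 0 \<le> ?D z)"
  proof safe
    fix z :: "real vec"
    assume min: "\<forall>z\<in>carrier_vec p. 0 \<le> \<alpha> * ?D z + 1 / 2 * ?Q z" and z: "z \<in> carrier_vec p"
    show "0 \<le> ?D z"
    proof (rule ccontr)
      assume "\<not> 0 \<le> ?D z"
      then have "0 < - \<alpha> * ?D z" using \<alpha> by (simp add: mult_pos_neg)
      \<comment> \<open>For small \<open>t\<close> the negative slack outweighs the quadratic term, of order \<open>t\<^sup>2\<close>.\<close>
      from eventually_positive_shift[OF this, of "- 1 / 2 * ?Q z"]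
      have "\<forall>\<^sub>F t in at_right (0::real). 0 < - \<alpha> * ?D z + t * (- 1 / 2 * ?Q z) \<and> t \<in> {0<..<1}"
        by (intro eventually_conj eventually_at_right_real) simp_all
      then obtain t where t: "0 < - \<alpha> * ?D z + t * (- 1 / 2 * ?Q z)" "0 < t" "t < 1"
        using eventually_happens'[OF trivial_limit_at_right_real] by (metis (no_types, lifting) greaterThanLessThan_iff)
      let ?z = "b + t \<cdot>\<^sub>v (z - b)"
      have zt: "?z \<in> carrier_vec p" "?z - b = t \<cdot>\<^sub>v (z - b)" using z b by auto
      have Qt: "?Q ?z = t * (t * ?Q z)"
        using X z b by (simp add: zt(2) mult_mat_vec[OF X] )
      have "slope_norm \<Lambda> ?z - slope_norm \<Lambda> b \<le> t * (slope_norm \<Lambda> z - slope_norm \<Lambda> b)"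
        using slope_norm_convex[OF L b z, of t] t by (simp add: algebra_simps)
      then have "?D ?z \<le> t * ?D z"
        using z b v unfolding zt(2) by (simp add: algebra_simps)
      then have "\<alpha> * ?D ?z \<le> \<alpha> * (t * ?D z)" using \<alpha> by simp
      moreover have "0 \<le> \<alpha> * ?D ?z + 1 / 2 * ?Q ?z" using min zt(1) by blast
      ultimately have "0 \<le> t * (\<alpha> * ?D z + t * (1 / 2 * ?Q z))"
        unfolding Qt by (simp add: algebra_simps)
      then have "0 \<le> \<alpha> * ?D z + t * (1 / 2 * ?Q z)"
        using t(2) by (simp only: zero_le_mult_iff) linarith
      with t(1) show False by linarith
    qed
  next
    fix z :: "real vec"
    assume "\<forall>z\<in>carrier_vec p. 0 \<le> ?D z" and z: "z \<in> carrier_vec p"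
    moreover have "0 \<le> ?Q z" by (simp add: scalar_prod_def sum_nonneg)
    ultimately show "0 \<le> \<alpha> * ?D z + 1 / 2 * ?Q z" using \<alpha> by (intro add_nonneg_nonneg) auto
  qed
  also have "\<dots> \<longleftrightarrow> v \<in> slope_subdiff \<Lambda> b"
    using v b by (auto simp: slope_subdiff_def algebra_simps)
  finally show ?thesis .
qed

section \<open>Patterns and pattern matrices\<close>

lemma abs_le_max_abs: "i < dim_vec v \<Longrightarrow> \<bar>v $ i\<bar> \<le> max_abs v"
  unfolding max_abs_def by (rule Max_ge) auto

lemma dim_sorted_abs: "dim_vec (sorted_abs v) = dim_vec v"
  by (simp add: sorted_abs_def)

lemma max_abs_sorted_abs: "max_abs (sorted_abs v) = max_abs v"
proof -
  have entries: "{\<bar>w $ i\<bar> | i. i < dim_vec w} = abs ` set (list_of_vec w)" for w :: "'a vec"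
    by (auto simp: list_of_vec_map)
  have "abs ` set (list_of_vec (sorted_abs v)) = abs ` set (list_of_vec v)"
    by (simp add: sorted_abs_def list_vec image_image)
  then show ?thesis
    unfolding max_abs_def entries by simp
qed

text \<open>
  The absolute value that \<open>U \<kappa>\<close> assigns to the entries of rank \<open>m\<close>.  Rank \<open>0\<close> carries the value \<open>0\<close>, and
  \<open>\<kappa>\<close> lists the values of the positive ranks from the highest rank down.
\<close>

definition pattern_level :: "real vec \<Rightarrow> int \<Rightarrow> real" where
  "pattern_level \<kappa> m = (if m \<le> 0 then 0 else \<kappa> $ nat (int (dim_vec \<kappa>) - m))"

lemma pattern_level_strict_mono:
  assumes "\<kappa> \<in> strict_decr_vecs k"
  shows "strict_mono_on {0..int k} (pattern_level \<kappa>)"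
proof (rule strict_mono_onI)
  fix a b assume ab: "a \<in> {0..int k}" "b \<in> {0..int k}" "a < b"
  have k: "dim_vec \<kappa> = k" and pos: "\<And>i. i < k \<Longrightarrow> 0 < \<kappa> $ i"
    and decr: "\<And>i j. i < j \<Longrightarrow> j < k \<Longrightarrow> \<kappa> $ j < \<kappa> $ i"
    using assms by (auto simp: strict_decr_vecs_def)
  show "pattern_level \<kappa> a < pattern_level \<kappa> b"
  proof (cases "a = 0")
    case True
    have "nat (int k - b) < k" using ab by auto
    then show ?thesis using True ab pos by (auto simp: pattern_level_def k)
  next
    case False
    have "nat (int k - b) < nat (int k - a)" "nat (int k - a) < k" using False ab by auto
    then show ?thesis using False ab decr by (auto simp: pattern_level_def k)
  qed
qed

lemma pattern_matrix_carrier: "pattern_matrix M \<in> carrier_mat (dim_vec M) (nat (max_abs M))"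
  by (simp add: pattern_matrix_def)

lemma pattern_matrix_mult_index:
  assumes \<kappa>: "\<kappa> \<in> carrier_vec (nat (max_abs M))" and i: "i < dim_vec M"
  shows "(pattern_matrix M *\<^sub>v \<kappa>) $ i = real_of_int (sgn (M $ i)) * pattern_level \<kappa> \<bar>M $ i\<bar>"
proof -
  let ?k = "nat (max_abs M)"
  have le: "\<bar>M $ i\<bar> \<le> max_abs M" by (rule abs_le_max_abs[OF i])
  have "(pattern_matrix M *\<^sub>v \<kappa>) $ i
      = (\<Sum>j<?k. real_of_int (sgn (M $ i)) * (if \<bar>M $ i\<bar> = max_abs M - int j then 1 else 0) * \<kappa> $ j)"
    using \<kappa> i by (simp add: pattern_matrix_def scalar_prod_def atLeast0LessThan)
  also have "\<dots> = (\<Sum>j<?k. if j = nat (max_abs M - \<bar>M $ i\<bar>) then real_of_int (sgn (M $ i)) * \<kappa> $ j else 0)"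
    using le by (intro sum.cong) auto
  also have "\<dots> = real_of_int (sgn (M $ i)) * pattern_level \<kappa> \<bar>M $ i\<bar>"
    using le \<kappa> by (auto simp: pattern_level_def)
  finally show ?thesis .
qed

lemma abs_pattern_matrix_mult_index:
  assumes \<kappa>: "\<kappa> \<in> strict_decr_vecs (nat (max_abs M))" and i: "i < dim_vec M"
  shows "\<bar>(pattern_matrix M *\<^sub>v \<kappa>) $ i\<bar> = pattern_level \<kappa> \<bar>M $ i\<bar>"
proof -
  have c: "\<kappa> \<in> carrier_vec (nat (max_abs M))" using \<kappa> by (simp add: strict_decr_vecs_def)
  have "0 \<le> pattern_level \<kappa> \<bar>M $ i\<bar>"
    using strict_mono_on_leD[OF pattern_level_strict_mono[OF \<kappa>], of 0 "\<bar>M $ i\<bar>"]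
      abs_le_max_abs[OF i] by (simp add: pattern_level_def[of _ 0])
  moreover have "pattern_level \<kappa> \<bar>M $ i\<bar> = 0" if "M $ i = 0" using that by (simp add: pattern_level_def)
  ultimately show ?thesis
    by (auto simp: pattern_matrix_mult_index[OF c i] abs_mult sgn_if)
qed

text \<open>
  Absolute values of \<open>U \<kappa>\<close> are a monotone function of the absolute values of \<open>M\<close>, so sorting commutes
  with passing from one to the other.
\<close>

lemma sorted_abs_pattern_matrix_mult:
  assumes \<kappa>: "\<kappa> \<in> strict_decr_vecs (nat (max_abs M))"
  shows "sorted_abs (pattern_matrix M *\<^sub>v \<kappa>) = pattern_matrix (sorted_abs M) *\<^sub>v \<kappa>"
proof (rule eq_vecI)
  let ?b = "pattern_matrix M *\<^sub>v \<kappa>" and ?ys = "map abs (list_of_vec M)" and ?h = "pattern_level \<kappa>"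
  have c: "\<kappa> \<in> carrier_vec (nat (max_abs (sorted_abs M)))"
    using \<kappa> by (simp add: strict_decr_vecs_def max_abs_sorted_abs)
  have dim: "dim_vec ?b = dim_vec M" by (simp add: pattern_matrix_def)
  have map: "map abs (list_of_vec ?b) = map ?h ?ys"
    by (rule nth_equalityI)
      (simp_all add: dim list_of_vec_index abs_pattern_matrix_mult_index[OF \<kappa>]
        del: index_mult_mat_vec dim_mult_mat_vec)
  have ran: "set ?ys \<subseteq> {0..int (nat (max_abs M))}"
  proof
    fix y assume "y \<in> set ?ys"
    then obtain i where "i < dim_vec M" "y = \<bar>M $ i\<bar>" by (auto simp: list_of_vec_map)
    with abs_le_max_abs[of i M] show "y \<in> {0..int (nat (max_abs M))}" by auto
  qed
  have "sorted (map ?h (sort ?ys))"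
  proof (rule sorted_map_mono)
    show "mono_on (set (sort ?ys)) ?h"
      using strict_mono_on_imp_mono_on[OF pattern_level_strict_mono[OF \<kappa>]] ran
      by (auto intro: mono_on_subset)
  qed simp
  then have "sort (map ?h ?ys) = map ?h (sort ?ys)"
    by (intro properties_for_sort) (simp_all add: multiset.map_comp)
  then have eq: "rev (sort (map abs (list_of_vec ?b))) = map ?h (rev (sort ?ys))"
    by (simp add: map rev_map)
  fix i assume "i < dim_vec (pattern_matrix (sorted_abs M) *\<^sub>v \<kappa>)"
  then have i: "i < dim_vec (sorted_abs M)" "i < dim_vec M" by (auto simp: pattern_matrix_def sorted_abs_def)
  have "sorted_abs M $ i \<ge> 0"
  proof -
    have "sorted_abs M $ i \<in> set ?ys"
      using i nth_mem[of i "rev (sort ?ys)"] by (simp add: sorted_abs_def vec_of_list_index)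
    then show ?thesis by auto
  qed
  moreover have "sorted_abs ?b $ i = ?h (sorted_abs M $ i)"
    using i unfolding sorted_abs_def by (simp add: eq vec_of_list_index del: vec_of_list_map)
  ultimately show "sorted_abs ?b $ i = (pattern_matrix (sorted_abs M) *\<^sub>v \<kappa>) $ i"
    by (auto simp: pattern_matrix_mult_index[OF c i(1)] sgn_if pattern_level_def)
qed (simp add: sorted_abs_def pattern_matrix_def)

text \<open>
  On vectors of one pattern the SLOPE norm is linear in the distinct absolute values.
\<close>

lemma slope_norm_pattern_matrix_mult:
  assumes \<kappa>: "\<kappa> \<in> strict_decr_vecs (nat (max_abs M))" and L: "\<Lambda> \<in> carrier_vec (dim_vec M)"
  shows "slope_norm \<Lambda> (pattern_matrix M *\<^sub>v \<kappa>) = reduced_penalty \<Lambda> M \<bullet> \<kappa>"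
proof -
  let ?S = "pattern_matrix (sorted_abs M)"
  have S: "?S \<in> carrier_mat (dim_vec M) (nat (max_abs M))"
    using pattern_matrix_carrier[of "sorted_abs M"] by (simp add: max_abs_sorted_abs dim_sorted_abs)
  have c: "\<kappa> \<in> carrier_vec (nat (max_abs M))" using \<kappa> by (simp add: strict_decr_vecs_def)
  have "slope_norm \<Lambda> (pattern_matrix M *\<^sub>v \<kappa>) = \<Lambda> \<bullet> (?S *\<^sub>v \<kappa>)"
    using carrier_matD[OF S] carrier_matD[OF pattern_matrix_carrier[of M]]
    by (simp add: slope_norm_def sorted_abs_pattern_matrix_mult[OF \<kappa>] scalar_prod_def
        atLeast0LessThan del: index_mult_mat_vec)
  then show ?thesis
    using transpose_vec_mult_scalar[OF S c L] by (simp add: reduced_penalty_def)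
qed

lemma card_rank_strict_mono_on:
  fixes V :: "'a::linorder set"
  assumes "finite V"
  shows "strict_mono_on V (\<lambda>a. card {v \<in> V. v \<le> a})"
proof (rule strict_mono_onI)
  fix a b assume ab: "a \<in> V" "b \<in> V" "a < b"
  then have "b \<in> {v \<in> V. v \<le> b}" "b \<notin> {v \<in> V. v \<le> a}" by auto
  moreover have "{v \<in> V. v \<le> a} \<subseteq> {v \<in> V. v \<le> b}" using ab(3) by auto
  ultimately have "{v \<in> V. v \<le> a} \<subset> {v \<in> V. v \<le> b}" by blast
  then show "card {v \<in> V. v \<le> a} < card {v \<in> V. v \<le> b}"
    using assms by (intro psubset_card_mono) auto
qed

text \<open>
  The rank function is strictly increasing with values in an interval of the size of \<open>V\<close>, so it attains
  all of them.  Hence a pattern has no gaps: every rank up to the largest one occurs.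
\<close>

lemma card_rank_bij_betw:
  fixes V :: "'a::linorder set"
  assumes V: "finite V"
  shows "bij_betw (\<lambda>a. card {v \<in> V. v \<le> a}) V {1..card V}"
proof -
  let ?r = "\<lambda>a. card {v \<in> V. v \<le> a}"
  have inj: "inj_on ?r V"
    using strict_mono_on_imp_inj_on[OF card_rank_strict_mono_on[OF V]] .
  have "?r a \<in> {1..card V}" if "a \<in> V" for a
  proof -
    have "{v \<in> V. v \<le> a} \<noteq> {}" using that by auto
    then have "0 < ?r a" using V by (simp add: card_gt_0_iff)
    moreover have "?r a \<le> card V" using V by (intro card_mono) auto
    ultimately show ?thesis by simp
  qed
  then have "?r ` V = {1..card V}"
    using card_image[OF inj] by (intro card_subset_eq) auto
  with inj show ?thesis by (simp add: bij_betw_def)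
qed

definition abs_values :: "real vec \<Rightarrow> real set" where
  "abs_values b = (\<lambda>j. \<bar>b $ j\<bar>) ` {j. j < dim_vec b \<and> b $ j \<noteq> 0}"

lemma finite_abs_values: "finite (abs_values b)"
  by (simp add: abs_values_def)

lemma abs_rank_eq: "abs_rank b i = card {v \<in> abs_values b. v \<le> \<bar>b $ i\<bar>}"
  by (auto simp: abs_rank_def abs_values_def intro!: arg_cong[of _ _ card])

lemma abs_rank_pos:
  assumes "i < dim_vec b"
  shows "0 < abs_rank b i \<longleftrightarrow> b $ i \<noteq> 0"
  using assms finite_abs_values[of b] unfolding abs_rank_eq card_gt_0_iff
  by (auto simp: abs_values_def)

lemma dim_patt: "dim_vec (patt b) = dim_vec b"
  by (simp add: patt_def)

lemma patt_index:
  assumes "i < dim_vec b"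
  shows "\<bar>patt b $ i\<bar> = int (abs_rank b i)" and "real_of_int (sgn (patt b $ i)) = sgn (b $ i)"
  using assms abs_rank_pos[OF assms] by (auto simp: patt_def)

lemma patt_abs_values:
  "(\<lambda>i. \<bar>patt b $ i\<bar>) ` {i. i < dim_vec b \<and> b $ i \<noteq> 0} = {1..int (card (abs_values b))}"
proof -
  have "(\<lambda>i. \<bar>patt b $ i\<bar>) ` {i. i < dim_vec b \<and> b $ i \<noteq> 0}
      = (\<lambda>i. int (card {v \<in> abs_values b. v \<le> \<bar>b $ i\<bar>})) ` {i. i < dim_vec b \<and> b $ i \<noteq> 0}"
    by (rule image_cong[OF refl]) (simp add: patt_index(1) abs_rank_eq)
  also have "\<dots> = (\<lambda>a. int (card {v \<in> abs_values b. v \<le> a})) ` abs_values b"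
    by (subst (3) abs_values_def) (simp add: image_image)
  also have "\<dots> = int ` {1..card (abs_values b)}"
    using bij_betw_imp_surj_on[OF card_rank_bij_betw[OF finite_abs_values[of b]], symmetric]
    by (simp only: image_image)
  also have "\<dots> = {1..int (card (abs_values b))}"
    by (simp add: image_int_atLeastAtMost)
  finally show ?thesis .
qed

lemma max_abs_patt:
  assumes "0 < dim_vec b"
  shows "max_abs (patt b) = int (card (abs_values b))"
proof -
  have [simp]: "dim_vec (patt b) = dim_vec b" by (simp add: patt_def)
  have le: "max_abs (patt b) \<le> int (card (abs_values b))"
    unfolding max_abs_def using assms
    by (subst Max_le_iff) (auto simp: patt_index(1) abs_rank_eq intro!: card_mono finite_abs_values)
  show ?thesis
  proof (cases "abs_values b = {}")
    case True
    with le abs_le_max_abs[of 0 "patt b"] assms show ?thesis by auto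
  next
    case False
    then have "int (card (abs_values b)) \<in> {1..int (card (abs_values b))}"
      using finite_abs_values[of b] by (simp add: Suc_le_eq card_gt_0_iff)
    then obtain i where "i < dim_vec b" "\<bar>patt b $ i\<bar> = int (card (abs_values b))"
      unfolding patt_abs_values[symmetric] by auto
    with le abs_le_max_abs[of i "patt b"] show ?thesis by simp
  qed
qed

text \<open>
  The coefficients \<open>\<kappa>\<close> are the distinct nonzero absolute values of \<open>b\<close> in decreasing order, obtained by
  inverting the rank function.
\<close>

lemma patt_imp_pattern_matrix_mult:
  assumes p: "0 < dim_vec b"
  obtains \<kappa> where "\<kappa> \<in> strict_decr_vecs (nat (max_abs (patt b)))" and "b = pattern_matrix (patt b) *\<^sub>v \<kappa>"
proof
  define V where "V = abs_values b"
  define k where "k = card V"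
  let ?r = "\<lambda>a. card {v \<in> V. v \<le> a}"
  define g where "g = the_inv_into V ?r"
  \<comment> \<open>Column \<open>j\<close> of the pattern matrix belongs to rank \<open>k - j\<close>.\<close>
  define \<kappa> where "\<kappa> = vec k (\<lambda>j. g (k - j))"
  have fin: "finite V" unfolding V_def by (rule finite_abs_values)
  have pos: "a \<in> V \<Longrightarrow> 0 < a" for a by (auto simp: V_def abs_values_def)
  have bij: "bij_betw ?r V {1..k}" unfolding k_def by (rule card_rank_bij_betw[OF fin])
  have gV: "g m \<in> V" and rg: "?r (g m) = m" if "m \<in> {1..k}" for m
    using bij that the_inv_into_into[of ?r V m V] f_the_inv_into_f[of ?r V m]
    by (auto simp: bij_betw_def g_def)
  have gr: "g (?r a) = a" if "a \<in> V" for a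
    unfolding g_def using bij that by (intro the_inv_into_f_f[of ?r]) (auto simp: bij_betw_def)
  have g_mono: "g m < g m'" if "m \<in> {1..k}" "m' \<in> {1..k}" "m < m'" for m m'
  proof -
    have "m' \<le> m" if "g m' \<le> g m"
      using strict_mono_on_leD[OF card_rank_strict_mono_on[OF fin] gV gV that] \<open>m \<in> {1..k}\<close> \<open>m' \<in> {1..k}\<close>
      by (simp add: rg del: atLeastAtMost_iff)
    with that(3) have "\<not> g m' \<le> g m" by linarith
    then show ?thesis by simp
  qed
  have k: "nat (max_abs (patt b)) = k" by (simp add: max_abs_patt[OF p] k_def V_def)
  show "\<kappa> \<in> strict_decr_vecs (nat (max_abs (patt b)))"
    unfolding k strict_decr_vecs_def using gV pos g_mono by (auto simp: \<kappa>_def)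
  then have c: "\<kappa> \<in> carrier_vec (nat (max_abs (patt b)))" by (simp add: strict_decr_vecs_def)
  show "b = pattern_matrix (patt b) *\<^sub>v \<kappa>"
  proof (rule eq_vecI)
    fix i assume "i < dim_vec (pattern_matrix (patt b) *\<^sub>v \<kappa>)"
    then have i: "i < dim_vec b" by (simp add: pattern_matrix_def patt_def)
    have "pattern_level \<kappa> \<bar>patt b $ i\<bar> = \<bar>b $ i\<bar>"
    proof (cases "b $ i = 0")
      case True
      then show ?thesis using abs_rank_pos[OF i] by (simp add: patt_index(1)[OF i] pattern_level_def)
    next
      case False
      then have a: "\<bar>b $ i\<bar> \<in> V" using i by (auto simp: V_def abs_values_def)
      then have "?r \<bar>b $ i\<bar> \<in> {1..k}" using bij by (auto simp: bij_betw_def)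
      then show ?thesis
        using gr[OF a] by (auto simp: patt_index(1)[OF i] pattern_level_def abs_rank_eq V_def[symmetric] \<kappa>_def
            nat_diff_distrib)
    qed
    then show "b $ i = (pattern_matrix (patt b) *\<^sub>v \<kappa>) $ i"
      using i pattern_matrix_mult_index[OF c, of i]
      by (simp add: patt_index(2) dim_patt sgn_mult_abs del: index_mult_mat_vec)
  qed (simp add: pattern_matrix_def dim_patt)
qed

text \<open>
  The signs of \<open>U \<kappa>\<close> are those of the pattern, and its absolute values are a strictly increasing
  function of the ranks.  Because all ranks up to the largest occur, exactly \<open>m\<close> distinct nonzero
  absolute values of \<open>U \<kappa>\<close> are at most the value of rank \<open>m\<close>.
\<close>

lemma patt_pattern_matrix_mult:
  assumes p: "0 < dim_vec b" and \<kappa>: "\<kappa> \<in> strict_decr_vecs (nat (max_abs (patt b)))"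
  shows "patt (pattern_matrix (patt b) *\<^sub>v \<kappa>) = patt b"
proof -
  let ?M = "patt b" and ?h = "pattern_level \<kappa>"
  define b' where "b' = pattern_matrix ?M *\<^sub>v \<kappa>"
  define k where "k = int (card (abs_values b))"
  have c: "\<kappa> \<in> carrier_vec (nat (max_abs ?M))" using \<kappa> by (simp add: strict_decr_vecs_def)
  have k: "max_abs ?M = k" using max_abs_patt[OF p] by (simp add: k_def)
  have mono: "strict_mono_on {0..k} ?h"
    using pattern_level_strict_mono[OF \<kappa>] by (simp add: k) (simp add: k_def)
  have inj: "inj_on ?h {0..k}" using strict_mono_on_imp_inj_on[OF mono] .
  have [simp]: "dim_vec ?M = dim_vec b" "dim_vec b' = dim_vec b"
    by (simp_all add: patt_def pattern_matrix_def b'_def)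
  have abs_b: "\<bar>b' $ i\<bar> = ?h \<bar>?M $ i\<bar>" and sgn_b: "sgn (b' $ i) = real_of_int (sgn (?M $ i))"
    if i: "i < dim_vec b" for i
  proof -
    show abs: "\<bar>b' $ i\<bar> = ?h \<bar>?M $ i\<bar>" using abs_pattern_matrix_mult_index[OF \<kappa>, of i] i by (simp add: b'_def del: index_mult_mat_vec)
    have "?h 0 < ?h \<bar>?M $ i\<bar>" if "?M $ i \<noteq> 0"
      using strict_mono_onD[OF mono, of 0 "\<bar>?M $ i\<bar>"] abs_le_max_abs[of i ?M] that i by (simp add: k)
    then show "sgn (b' $ i) = real_of_int (sgn (?M $ i))"
      using pattern_matrix_mult_index[OF c, of i] i
      by (cases "?M $ i = 0") (auto simp: sgn_mult pattern_level_def sgn_if b'_def simp del: index_mult_mat_vec)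
  qed
  have range: "\<bar>?M $ i\<bar> \<in> {0..k}" if "i < dim_vec b" for i
    using abs_le_max_abs[of i ?M] that by (simp add: k)
  have zero: "b' $ i = 0 \<longleftrightarrow> b $ i = 0" if "i < dim_vec b" for i
    using sgn_b[OF that] patt_index(2)[OF that] by (metis sgn_0_0)
  have abs_values_eq: "abs_values b' = ?h ` {1..k}"
  proof -
    have "abs_values b' = (\<lambda>i. ?h \<bar>?M $ i\<bar>) ` {i. i < dim_vec b \<and> b $ i \<noteq> 0}"
      unfolding abs_values_def by (rule image_cong) (auto simp: zero abs_b)
    then show ?thesis by (simp add: k_def flip: patt_abs_values) (simp add: image_image)
  qed
  have rank: "int (abs_rank b' i) = \<bar>?M $ i\<bar>" if i: "i < dim_vec b" for i
  proof -
    have "?h m \<le> ?h \<bar>?M $ i\<bar> \<longleftrightarrow> m \<le> \<bar>?M $ i\<bar>" if "m \<in> {1..k}" for m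
      using strict_mono_on_less_eq[OF mono, of m "\<bar>?M $ i\<bar>"] range[OF i] that by auto
    then have "{v \<in> abs_values b'. v \<le> \<bar>b' $ i\<bar>} = ?h ` {1..\<bar>?M $ i\<bar>}"
      using range[OF i] by (auto simp: abs_values_eq abs_b[OF i])
    moreover have "inj_on ?h {1..\<bar>?M $ i\<bar>}"
      using range[OF i] by (intro inj_on_subset[OF inj]) auto
    ultimately show ?thesis by (simp add: abs_rank_eq card_image)
  qed
  have "patt b' = ?M"
  proof (rule eq_vecI)
    fix i assume "i < dim_vec ?M"
    then have i: "i < dim_vec b" by simp
    have "patt b' $ i = sgn (patt b' $ i) * \<bar>patt b' $ i\<bar>" by (simp add: sgn_mult_abs)
    also have "\<dots> = sgn (?M $ i) * \<bar>?M $ i\<bar>"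
      using patt_index[of i b'] sgn_b[OF i] rank[OF i] i by simp
    finally show "patt b' $ i = ?M $ i" by (simp add: sgn_mult_abs)
  qed (simp add: patt_def)
  then show ?thesis by (simp add: b'_def)
qed

text \<open>
  An integer vector is itself of the form \<open>U \<kappa>\<close>, with \<open>\<kappa> = (k, k - 1, \<dots>, 1)\<close>, where \<open>k\<close> is its
  largest absolute entry; this brings the subdifferential at \<open>M\<close> under the description for \<open>U \<kappa>\<close>.
\<close>

lemma pattern_eq_pattern_matrix_mult:
  obtains \<kappa> where "\<kappa> \<in> strict_decr_vecs (nat (max_abs M))"
    and "map_vec real_of_int M = pattern_matrix M *\<^sub>v \<kappa>"
proof
  define k where "k = nat (max_abs M)"
  define \<kappa> where "\<kappa> = vec k (\<lambda>j. real (k - j))"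
  show "\<kappa> \<in> strict_decr_vecs (nat (max_abs M))"
    by (auto simp: strict_decr_vecs_def \<kappa>_def k_def)
  then have c: "\<kappa> \<in> carrier_vec (nat (max_abs M))" by (simp add: strict_decr_vecs_def)
  have level: "pattern_level \<kappa> m = real_of_int m" if "0 \<le> m" "m \<le> max_abs M" for m
    using that by (auto simp: pattern_level_def \<kappa>_def k_def)
  show "map_vec real_of_int M = pattern_matrix M *\<^sub>v \<kappa>"
  proof (rule eq_vecI)
    fix i assume "i < dim_vec (pattern_matrix M *\<^sub>v \<kappa>)"
    then have i: "i < dim_vec M" by (simp add: pattern_matrix_def)
    show "map_vec real_of_int M $ i = (pattern_matrix M *\<^sub>v \<kappa>) $ i"
      using i abs_le_max_abs[OF i]
      by (simp add: pattern_matrix_mult_index[OF c i] level sgn_mult_abs del: of_int_mult of_int_abs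
          flip: of_int_mult)
  qed (simp add: pattern_matrix_def)
qed

section \<open>Subdifferential at a vector of given pattern\<close>

text \<open>
  Openness along rays: finitely many strict inequalities between affine functions of \<open>t\<close> survive for
  small \<open>t\<close>.
\<close>

lemma strict_decr_vecs_open:
  assumes k: "\<kappa> \<in> strict_decr_vecs k" and c: "c \<in> carrier_vec k"
  shows "\<forall>\<^sub>F t in at_right 0. \<kappa> + t \<cdot>\<^sub>v c \<in> strict_decr_vecs k"
proof -
  have "\<forall>\<^sub>F t in at_right 0. \<forall>i\<in>{..<k}. 0 < \<kappa> $ i + t * c $ i"
    using k by (intro eventually_ball_finite ballI eventually_positive_shift)
      (auto simp: strict_decr_vecs_def)
  moreover have "\<forall>\<^sub>F t in at_right 0. \<forall>(i, j)\<in>{(i, j). i < j \<and> j < k}.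
      0 < (\<kappa> $ i - \<kappa> $ j) + t * (c $ i - c $ j)"
  proof (rule eventually_ball_finite)
    show "finite {(i, j). i < j \<and> j < k}"
      by (rule finite_subset[of _ "{..<k} \<times> {..<k}"]) auto
  qed (use k in \<open>auto intro!: eventually_positive_shift simp: strict_decr_vecs_def\<close>)
  ultimately show ?thesis
  proof eventually_elim
    case (elim t)
    have "\<kappa> $ j + t * c $ j < \<kappa> $ i + t * c $ i" if "i < j" "j < k" for i j
      using bspec[OF elim(2), of "(i, j)"] that by (simp add: algebra_simps)
    then show ?case
      using elim(1) k c by (auto simp: strict_decr_vecs_def)
  qed
qed

lemma reduced_penalty_carrier: "reduced_penalty \<Lambda> M \<in> carrier_vec (nat (max_abs M))"
  by (rule carrier_vecI) (simp add: reduced_penalty_def pattern_matrix_def max_abs_sorted_abs)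

text \<open>
  The right-hand side is independent of \<open>\<kappa>\<close>.  For necessity, put \<open>d = U\<^sup>T v - l\<close> and test the
  subgradient inequality at \<open>U (\<kappa> + t d)\<close> for a small \<open>t > 0\<close>: the norm changes by \<open>t (l \<bullet> d)\<close>, the linear
  bound by \<open>t ((U\<^sup>T v) \<bullet> d)\<close>, and therefore \<open>d \<bullet> d \<le> 0\<close>.  Then \<open>v \<bullet> (U \<kappa>) = l \<bullet> \<kappa>\<close> is the norm of
  \<open>U \<kappa>\<close>, and the constant terms of the subgradient inequality cancel.
\<close>

lemma slope_subdiff_pattern_iff:
  assumes \<kappa>: "\<kappa> \<in> strict_decr_vecs (nat (max_abs M))" and L: "\<Lambda> \<in> carrier_vec (dim_vec M)"
  shows "v \<in> slope_subdiff \<Lambda> (pattern_matrix M *\<^sub>v \<kappa>) \<longleftrightarrow>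
    v \<in> carrier_vec (dim_vec M) \<and> (\<forall>z\<in>carrier_vec (dim_vec M). v \<bullet> z \<le> slope_norm \<Lambda> z) \<and>
    transpose_mat (pattern_matrix M) *\<^sub>v v = reduced_penalty \<Lambda> M"
proof -
  define p k U l where "p = dim_vec M" and "k = nat (max_abs M)" and "U = pattern_matrix M"
    and "l = reduced_penalty \<Lambda> M"
  have U: "U \<in> carrier_mat p k" using pattern_matrix_carrier[of M] by (simp add: U_def p_def k_def)
  have l: "l \<in> carrier_vec k"
    by (simp add: l_def k_def reduced_penalty_carrier)
  have c: "\<kappa> \<in> carrier_vec k" using \<kappa> by (simp add: strict_decr_vecs_def k_def)
  have Uc: "U *\<^sub>v \<kappa> \<in> carrier_vec p" using U c by simp
  have J: "slope_norm \<Lambda> (U *\<^sub>v \<mu>) = l \<bullet> \<mu>" if "\<mu> \<in> strict_decr_vecs k" for \<mu>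
    using slope_norm_pattern_matrix_mult[of \<mu> M \<Lambda>] that L by (simp add: U_def l_def k_def)
  have adj: "v \<bullet> (U *\<^sub>v \<mu>) = (transpose_mat U *\<^sub>v v) \<bullet> \<mu>" if "v \<in> carrier_vec p" "\<mu> \<in> carrier_vec k" for \<mu>
    using transpose_vec_mult_scalar[OF U that(2,1)] by simp
  have "v \<in> slope_subdiff \<Lambda> (U *\<^sub>v \<kappa>) \<longleftrightarrow>
      v \<in> carrier_vec p \<and> (\<forall>z\<in>carrier_vec p. v \<bullet> z \<le> slope_norm \<Lambda> z) \<and> transpose_mat U *\<^sub>v v = l"
    (is "?L \<longleftrightarrow> ?R")
  proof
    assume ?L
    then have v: "v \<in> carrier_vec p"
      and sub: "\<And>z. z \<in> carrier_vec p \<Longrightarrow> slope_norm \<Lambda> (U *\<^sub>v \<kappa>) + v \<bullet> (z - U *\<^sub>v \<kappa>) \<le> slope_norm \<Lambda> z"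
      using U by (auto simp: slope_subdiff_def)
    define d where "d = transpose_mat U *\<^sub>v v - l"
    have d: "d \<in> carrier_vec k" using U v l by (simp add: d_def)
    have "\<forall>\<^sub>F t in at_right (0::real). \<kappa> + t \<cdot>\<^sub>v d \<in> strict_decr_vecs k \<and> t \<in> {0<..<1}"
      using strict_decr_vecs_open[of \<kappa> k d] \<kappa> d
      by (intro eventually_conj eventually_at_right_real) (simp_all add: k_def)
    then obtain t where t: "\<kappa> + t \<cdot>\<^sub>v d \<in> strict_decr_vecs k" "0 < t"
      using eventually_happens'[OF trivial_limit_at_right_real]
      by (metis (no_types, lifting) greaterThanLessThan_iff)
    have Ut: "U *\<^sub>v (\<kappa> + t \<cdot>\<^sub>v d) = U *\<^sub>v \<kappa> + t \<cdot>\<^sub>v (U *\<^sub>v d)"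
      using U c d by (simp add: mult_add_distrib_mat_vec[OF U] mult_mat_vec[OF U])
    have "U *\<^sub>v (\<kappa> + t \<cdot>\<^sub>v d) - U *\<^sub>v \<kappa> = t \<cdot>\<^sub>v (U *\<^sub>v d)"
      unfolding Ut using U c d by (intro eq_vecI) auto
    then have "l \<bullet> \<kappa> + v \<bullet> (t \<cdot>\<^sub>v (U *\<^sub>v d)) \<le> l \<bullet> (\<kappa> + t \<cdot>\<^sub>v d)"
      using sub[of "U *\<^sub>v (\<kappa> + t \<cdot>\<^sub>v d)"] J[OF t(1)] J[of \<kappa>] \<kappa> U c d by (simp add: k_def)
    then have "t * ((transpose_mat U *\<^sub>v v) \<bullet> d) \<le> t * (l \<bullet> d)"
      using l c d U v adj[OF v d] by (simp add: scalar_prod_add_distrib[of _ k])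
    then have "(transpose_mat U *\<^sub>v v) \<bullet> d - l \<bullet> d \<le> 0"
      using t(2) by simp
    then have "d \<bullet> d \<le> 0"
      using U v l d by (simp add: d_def minus_scalar_prod_distrib[of _ k])
    then have "(\<Sum>i<k. d $ i * d $ i) \<le> 0"
      using d by (simp add: scalar_prod_def atLeast0LessThan)
    moreover have "0 \<le> (\<Sum>i<k. d $ i * d $ i)" by (intro sum_nonneg) simp
    ultimately have "(\<Sum>i<k. d $ i * d $ i) = 0" by linarith
    then have "d = 0\<^sub>v k"
      using d by (subst (asm) sum_nonneg_eq_0_iff) (auto intro!: eq_vecI)
    moreover have "transpose_mat U *\<^sub>v v = d + l"
      unfolding d_def using U v l by (intro eq_vecI) auto
    ultimately have Uv: "transpose_mat U *\<^sub>v v = l" using l by simp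
    have "v \<bullet> (U *\<^sub>v \<kappa>) = slope_norm \<Lambda> (U *\<^sub>v \<kappa>)"
      using adj[OF v c] J[of \<kappa>] \<kappa> by (simp add: Uv k_def)
    then have "v \<bullet> z \<le> slope_norm \<Lambda> z" if "z \<in> carrier_vec p" for z
      using sub[OF that] v that Uc by (simp add: scalar_prod_minus_distrib[of _ p])
    with v Uv show ?R by blast
  next
    assume R: ?R
    then have "v \<bullet> (U *\<^sub>v \<kappa>) = slope_norm \<Lambda> (U *\<^sub>v \<kappa>)"
      using adj[OF _ c] J[of \<kappa>] \<kappa> by (simp add: k_def)
    then show ?L
      using R U Uc by (auto simp: slope_subdiff_def scalar_prod_minus_distrib[of _ p])
  qed
  then show ?thesis by (simp add: U_def p_def l_def)
qed

section \<open>Attainability of the pattern from noiseless data\<close>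

theorem corollary3p3:
  fixes n p :: nat and X :: "real mat" and \<beta> \<Lambda> :: "real vec" and M :: "int vec"
  assumes "X \<in> carrier_mat n p"
    and "\<beta> \<in> carrier_vec p"
    and "patt \<beta> = M"
    and "M \<noteq> 0\<^sub>v p"
    and "\<Lambda> \<in> strict_decr_vecs p"
  shows
    "((\<exists>\<alpha>>0. \<exists>b \<in> slope_minimizers X \<alpha> \<Lambda> (X *\<^sub>v \<beta>). patt b = patt \<beta>)
       \<longleftrightarrow> (\<exists>\<alpha>\<^sub>0>0. \<forall>\<alpha> \<in> {0<..<\<alpha>\<^sub>0}.
             \<exists>b \<in> slope_minimizers X \<alpha> \<Lambda> (X *\<^sub>v \<beta>). patt b = patt \<beta>))
     \<and> ((\<exists>\<alpha>\<^sub>0>0. \<forall>\<alpha> \<in> {0<..<\<alpha>\<^sub>0}.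
             \<exists>b \<in> slope_minimizers X \<alpha> \<Lambda> (X *\<^sub>v \<beta>). patt b = patt \<beta>)
       \<longleftrightarrow> transpose_mat X *\<^sub>v (mp_inverse (transpose_mat (reduced_design X M)) *\<^sub>v reduced_penalty \<Lambda> M)
             \<in> slope_subdiff \<Lambda> (map_vec real_of_int M))"
proof -
  note X = assms(1) and \<beta> = assms(2) and L = assms(5)
  define k U l A w where "k = nat (max_abs M)" and "U = pattern_matrix M"
    and "l = reduced_penalty \<Lambda> M" and "A = X * U"
    and "w = mp_inverse (transpose_mat A) *\<^sub>v l"
  let ?recovers = "\<lambda>\<alpha>. \<exists>b \<in> slope_minimizers X \<alpha> \<Lambda> (X *\<^sub>v \<beta>). patt b = patt \<beta>"
  let ?iii = "transpose_mat X *\<^sub>v w \<in> slope_subdiff \<Lambda> (map_vec real_of_int M)"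
  have dimM: "dim_vec M = p" using assms(2,3) by (auto simp: dim_patt)
  have "p > 0"
  proof (rule ccontr)
    assume "\<not> p > 0"
    then have "M = 0\<^sub>v p" using dimM by (intro eq_vecI) auto
    with assms(4) show False by contradiction
  qed
  then have p: "0 < dim_vec \<beta>" using \<beta> by simp
  have U: "U \<in> carrier_mat p k" using pattern_matrix_carrier[of M] by (simp add: U_def k_def dimM)
  have A: "A \<in> carrier_mat n k" using X U by (simp add: A_def)
  have l: "l \<in> carrier_vec k"
    by (simp add: l_def k_def reduced_penalty_carrier)
  have Lc: "\<Lambda> \<in> carrier_vec (dim_vec M)" using L by (simp add: strict_decr_vecs_def dimM)
  obtain s where s: "s \<in> strict_decr_vecs k" and \<beta>_eq: "\<beta> = U *\<^sub>v s"
    using patt_imp_pattern_matrix_mult[OF p] by (auto simp: assms(3) k_def U_def)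
  have sc: "s \<in> carrier_vec k" using s by (simp add: strict_decr_vecs_def)
  obtain \<mu> where \<mu>: "\<mu> \<in> strict_decr_vecs k" "map_vec real_of_int M = U *\<^sub>v \<mu>"
    using pattern_eq_pattern_matrix_mult[of M] by (auto simp: k_def U_def)
  have subdiff_eq: "slope_subdiff \<Lambda> (U *\<^sub>v \<kappa>) = slope_subdiff \<Lambda> (map_vec real_of_int M)"
    if "\<kappa> \<in> strict_decr_vecs k" for \<kappa>
    using slope_subdiff_pattern_iff[of _ M \<Lambda>] that \<mu> Lc by (auto simp: k_def U_def)
  have subdiff_U: "transpose_mat U *\<^sub>v v = l" if "v \<in> slope_subdiff \<Lambda> (map_vec real_of_int M)" for v
    using slope_subdiff_pattern_iff[of \<mu> M \<Lambda> v] that \<mu> Lc by (simp add: k_def U_def l_def)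
  have residual: "X *\<^sub>v \<beta> - X *\<^sub>v (U *\<^sub>v (s + t \<cdot>\<^sub>v c)) = (- t) \<cdot>\<^sub>v (A *\<^sub>v c)" if "c \<in> carrier_vec k" for c t
  proof -
    have "X *\<^sub>v (U *\<^sub>v (s + t \<cdot>\<^sub>v c)) = A *\<^sub>v (s + t \<cdot>\<^sub>v c)"
      unfolding A_def by (rule assoc_mult_mat_vec[OF X U, symmetric]) (use sc that in simp)
    also have "\<dots> = A *\<^sub>v s + t \<cdot>\<^sub>v (A *\<^sub>v c)"
      using that sc by (simp add: mult_add_distrib_mat_vec[OF A] mult_mat_vec[OF A])
    moreover have "X *\<^sub>v \<beta> = A *\<^sub>v s"
      unfolding A_def \<beta>_eq by (rule assoc_mult_mat_vec[OF X U sc, symmetric])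
    ultimately show ?thesis using A that sc by (intro eq_vecI) auto
  qed
  have "?iii" if "0 < \<alpha>" and b: "b \<in> slope_minimizers X \<alpha> \<Lambda> (X *\<^sub>v \<beta>)" "patt b = patt \<beta>" for \<alpha> b
  proof -
    have bc: "b \<in> carrier_vec p" using b(1) X by (simp add: slope_minimizers_def is_arg_min_def)
    then obtain \<kappa> where \<kappa>: "\<kappa> \<in> strict_decr_vecs k" and b_eq: "b = U *\<^sub>v \<kappa>"
      using patt_imp_pattern_matrix_mult[of b] p \<beta> by (auto simp: b(2) assms(3) k_def U_def)
    have kc: "\<kappa> \<in> carrier_vec k" using \<kappa> by (simp add: strict_decr_vecs_def)
    \<comment> \<open>The scaling makes \<open>X\<^sup>T (A c)\<close> the subgradient of the optimality condition.\<close>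
    define c where "c = (1 / \<alpha>) \<cdot>\<^sub>v (s - \<kappa>)"
    have c: "c \<in> carrier_vec k" using sc kc by (simp add: c_def)
    have "\<kappa> = s + (- \<alpha>) \<cdot>\<^sub>v c" using sc kc \<open>0 < \<alpha>\<close> by (intro eq_vecI) (auto simp: c_def)
    then have "X *\<^sub>v \<beta> - X *\<^sub>v b = \<alpha> \<cdot>\<^sub>v (A *\<^sub>v c)"
      using residual[OF c, of "- \<alpha>"] by (simp add: b_eq)
    then have grad: "transpose_mat X *\<^sub>v (X *\<^sub>v \<beta> - X *\<^sub>v b) = \<alpha> \<cdot>\<^sub>v (transpose_mat X *\<^sub>v (A *\<^sub>v c))"
      using X A c by (simp add: mult_mat_vec[of _ p n])
    have v: "transpose_mat X *\<^sub>v (A *\<^sub>v c) \<in> slope_subdiff \<Lambda> (map_vec real_of_int M)"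
      using slope_minimizers_iff_subdiff[OF X _ bc L \<open>0 < \<alpha>\<close> _ grad] b(1) X A c \<beta>
      by (simp add: b_eq subdiff_eq[OF \<kappa>])
    have "transpose_mat A *\<^sub>v (A *\<^sub>v c) = transpose_mat U *\<^sub>v (transpose_mat X *\<^sub>v (A *\<^sub>v c))"
      unfolding A_def transpose_mult[OF X U]
      by (rule assoc_mult_mat_vec[of _ k p _ n]) (use X U A c in \<open>simp_all add: A_def[symmetric]\<close>)
    then have "transpose_mat A *\<^sub>v (A *\<^sub>v c) = l" using subdiff_U[OF v] by simp
    then have "w = A *\<^sub>v c"
      using mp_inverse_transpose_left_inverse[OF A c] by (simp add: w_def)
    with v show ?thesis by simp
  qed
  moreover have "\<exists>\<alpha>\<^sub>0>0. \<forall>\<alpha> \<in> {0<..<\<alpha>\<^sub>0}. ?recovers \<alpha>" if iii: ?iii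
  proof -
    obtain c where c: "c \<in> carrier_vec k" and w: "w = A *\<^sub>v c"
      using mp_inverse_transpose_in_range[OF A l] unfolding w_def by metis
    have "\<forall>\<^sub>F \<alpha> in at_right 0. s + \<alpha> \<cdot>\<^sub>v ((- 1) \<cdot>\<^sub>v c) \<in> strict_decr_vecs k"
      using c by (intro strict_decr_vecs_open[OF s]) simp
    then obtain \<alpha>\<^sub>0 where \<alpha>\<^sub>0: "0 < \<alpha>\<^sub>0" "\<And>\<alpha>. 0 < \<alpha> \<Longrightarrow> \<alpha> < \<alpha>\<^sub>0 \<Longrightarrow> s + \<alpha> \<cdot>\<^sub>v ((- 1) \<cdot>\<^sub>v c) \<in> strict_decr_vecs k"
      unfolding eventually_at_right_field by blast
    have "?recovers \<alpha>" if "0 < \<alpha>" "\<alpha> < \<alpha>\<^sub>0" for \<alpha>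
    proof
      define \<kappa> where "\<kappa> = s + \<alpha> \<cdot>\<^sub>v ((- 1) \<cdot>\<^sub>v c)"
      have \<kappa>: "\<kappa> \<in> strict_decr_vecs k" using \<alpha>\<^sub>0(2)[OF that] by (simp add: \<kappa>_def)
      have bc: "U *\<^sub>v \<kappa> \<in> carrier_vec p" using U \<kappa> by (simp add: strict_decr_vecs_def)
      show "patt (U *\<^sub>v \<kappa>) = patt \<beta>"
        using patt_pattern_matrix_mult[OF p, of \<kappa>] \<kappa> by (simp add: assms(3) U_def k_def)
      have "A *\<^sub>v ((- 1) \<cdot>\<^sub>v c) = (- 1) \<cdot>\<^sub>v w" using c w by (simp add: mult_mat_vec[OF A])
      then have "X *\<^sub>v \<beta> - X *\<^sub>v (U *\<^sub>v \<kappa>) = \<alpha> \<cdot>\<^sub>v w"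
        using residual[of "(- 1) \<cdot>\<^sub>v c" \<alpha>] c by (simp add: \<kappa>_def smult_smult_assoc)
      then have grad: "transpose_mat X *\<^sub>v (X *\<^sub>v \<beta> - X *\<^sub>v (U *\<^sub>v \<kappa>)) = \<alpha> \<cdot>\<^sub>v (transpose_mat X *\<^sub>v w)"
        using X A c w by (simp add: mult_mat_vec[of _ p n])
      show "U *\<^sub>v \<kappa> \<in> slope_minimizers X \<alpha> \<Lambda> (X *\<^sub>v \<beta>)"
        using slope_minimizers_iff_subdiff[OF X _ bc L \<open>0 < \<alpha>\<close> _ grad] iii X \<beta> A c
        by (simp add: subdiff_eq[OF \<kappa>] w)
    qed
    with \<alpha>\<^sub>0(1) show ?thesis by auto
  qed
  moreover have "\<exists>\<alpha>>0. ?recovers \<alpha>" if ii: "\<exists>\<alpha>\<^sub>0>0. \<forall>\<alpha> \<in> {0<..<\<alpha>\<^sub>0}. ?recovers \<alpha>"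
  proof -
    obtain \<alpha>\<^sub>0 :: real where "0 < \<alpha>\<^sub>0" "\<forall>\<alpha> \<in> {0<..<\<alpha>\<^sub>0}. ?recovers \<alpha>" using ii by blast
    then show ?thesis by (intro exI[of _ "\<alpha>\<^sub>0 / 2"]) auto
  qed
  ultimately show ?thesis
    unfolding reduced_design_def U_def[symmetric] A_def[symmetric] l_def[symmetric] w_def[symmetric]
    by blast
qed

end
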